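(* Let $n$ be a positive integer, and let $m(n)$, $\mathcal Z(n)$, $H_z(n)$, $K_z(n)$ be as in the context. Suppose that $\delta_3(n)=0$. Then $z\mapsto\{H_z(n),K_z(n)\}$ is a bijection from $\mathcal Z(n)$ onto the set of unordered representations of $2n$ as a sum of two positive integers both coprime to $6$. Suppose that $\delta_3(n)\in\{1,2\}$. Then the fibers of the same map $z\mapsto\{H_z(n),K_z(n)\}$ on $\mathcal Z(n)$ are precisely the orbits of the involution $\tau_n(z)=m(n)-z$. A fixed parameter (a $z\in\mathcal Z(n)$ with $\tau_n(z)=z$) exists exactly when $m(n)$ is even. When it exists, it gives $H_z(n)=K_z(n)=n$.
   Context: For $q\in\mathbb Z_{>0}$ and $x\in\mathbb Z$, $\delta_q(x)=x-q\lfloor x/q\rfloor$. $m(n)=\frac n3-1$ if $\delta_3(n)=0$; $m(n)=\frac{n-1}{3}$ if $\delta_3(n)=1$; $m(n)=\frac{n-5}{3}$ if $\delta_3(n)=2$. $\mathcal Z(n)=\{z\in\mathbb Z:0\le z\le m(n)\}$ (empty for $n=2$, where $m(2)=-1$). For $z\in\mathcal Z(n)$: if $\delta_3(n)=0$, $H_z(n)=6z+1$, $K_z(n)=6(m(n)-z)+5$; if $\delta_3(n)=1$, $H_z(n)=6z+1$, $K_z(n)=6(m(n)-z)+1$; if $\delta_3(n)=2$, $H_z(n)=6z+5$, $K_z(n)=6(m(n)-z)+5$. In every case $H_z(n)+K_z(n)=2n$. Here $\{H_z(n),K_z(n)\}$ denotes the unordered pair (the two summands may be equal). *)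

theory Defs
  imports Complex_Main "HOL-Library.Uprod" "HOL-Combinatorics.Orbits"
begin

definition delta :: "int \<Rightarrow> int \<Rightarrow> int" where
  "delta q x = x - q * \<lfloor>real_of_int x / real_of_int q\<rfloor>"

text \<open>The divisions by 3 are exact in the respective branches; the last branch is
  \<open>delta 3 n = 2\<close>.\<close>
definition m :: "int \<Rightarrow> int" where
  "m n = (if delta 3 n = 0 then n div 3 - 1
          else if delta 3 n = 1 then (n - 1) div 3
          else (n - 5) div 3)"

definition Z :: "int \<Rightarrow> int set" where
  "Z n = {z. 0 \<le> z \<and> z \<le> m n}"

definition H :: "int \<Rightarrow> int \<Rightarrow> int" where
  "H n z = (if delta 3 n = 0 then 6 * z + 1
            else if delta 3 n = 1 then 6 * z + 1
            else 6 * z + 5)"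

definition K :: "int \<Rightarrow> int \<Rightarrow> int" where
  "K n z = (if delta 3 n = 0 then 6 * (m n - z) + 5
            else if delta 3 n = 1 then 6 * (m n - z) + 1
            else 6 * (m n - z) + 5)"

definition HK :: "int \<Rightarrow> int \<Rightarrow> int uprod" where
  "HK n z = Upair (H n z) (K n z)"

definition reps :: "int \<Rightarrow> int uprod set" where
  "reps n = {Upair a b | a b. a > 0 \<and> b > 0 \<and> coprime a 6 \<and> coprime b 6 \<and> a + b = 2 * n}"

text \<open>As \<open>tau n\<close> is an involution, the library orbit \<open>orbit (tau n) z\<close> (strictly positive
  iterates) contains \<open>z\<close> itself and is the usual group orbit.\<close>
definition tau :: "int \<Rightarrow> int \<Rightarrow> int" where
  "tau n z = m n - z"

end

theory Submission
  imports Defs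
begin

text \<open>An integer is coprime to 6 exactly when it is 1 or 5 mod 6. If 3 divides
  \<open>n\<close>, then 2n is 0 mod 6, so a representation has one summand of each class; the
  summand that is 1 mod 6 orders the pair and determines \<open>z\<close>, which gives the bijection
  (\<open>bij_betw_HK\<close>). Otherwise \<open>H n\<close> and \<open>K n\<close> run through the
  same progression in opposite directions: \<open>K n z = H n (tau n z)\<close>. Since
  \<open>H n\<close> is injective, two parameters give the same unordered pair only if they are
  equal or exchanged by \<open>tau n\<close> (\<open>HK_eq_iff\<close>), so fibers are orbits. A
  fixed parameter is half of \<open>m n\<close>, and there both summands equal half of 2n.\<close>

lemma delta_eq_mod: "delta q x = x mod q"
  unfolding delta_def by (simp add: floor_divide_of_int_eq minus_mult_div_eq_mod)

text \<open>The gcd with 6 depends only on the residue mod 6, which leaves six cases.\<close>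

lemma coprime_6_iff: "coprime a 6 \<longleftrightarrow> a mod 6 = 1 \<or> a mod 6 = 5" for a :: int
proof -
  have "a mod 6 \<in> {0, 1, 2, 3, 4, 5}"
    by (simp, presburger)
  moreover have "coprime a 6 \<longleftrightarrow> gcd 6 (a mod 6) = 1"
    by (simp only: coprime_iff_gcd_eq_1 gcd_red_int[of a 6])
  moreover have "\<not> coprime 6 (3 :: int)" "\<not> coprime 6 (4 :: int)"
    using coprime_common_divisor[of 6 "3 :: int" 3] coprime_common_divisor[of 6 "4 :: int" 2]
    by auto
  ultimately show ?thesis
    by (auto simp: gcd_non_0_int)
qed

text \<open>\<open>orbit\<close> collects strictly positive iterates, so \<open>x\<close> enters
  only as \<open>f (f x)\<close>.\<close>

lemma orbit_involution:
  assumes "f (f x) = x"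
  shows "orbit f x = {x, f x}"
proof
  show "orbit f x \<subseteq> {x, f x}"
  proof
    fix y assume "y \<in> orbit f x"
    then show "y \<in> {x, f x}"
      by induction (auto simp: assms)
  qed
  have "f x \<in> orbit f x"
    by (rule orbit.base)
  moreover from this have "f (f x) \<in> orbit f x"
    by (rule orbit.step)
  ultimately show "{x, f x} \<subseteq> orbit f x"
    by (simp add: assms)
qed

lemma bij_betw_HK:
  assumes "n mod 3 = 0"
  shows "bij_betw (HK n) (Z n) (reps n)"
proof -
  obtain t where n: "n = 3 * t"
    using assms by (auto simp: mod_eq_0_iff_dvd)
  have HK: "HK n z = Upair (6 * z + 1) (6 * (t - 1 - z) + 5)" for z
    by (simp add: HK_def H_def K_def m_def delta_eq_mod n)
  have Z: "Z n = {0..t - 1}"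
    by (auto simp: Z_def m_def delta_eq_mod n)
  have "inj_on (HK n) (Z n)"
  proof (rule inj_onI)
    fix y z assume "HK n y = HK n z"
    then show "y = z"
      \<comment> \<open>A crossed match of the pairs would equate a number that is 1 mod 6 with one
        that is 5 mod 6.\<close>
      unfolding HK Upair_inject by presburger
  qed
  moreover have "HK n ` Z n \<subseteq> reps n"
  proof
    fix p assume "p \<in> HK n ` Z n"
    then obtain z where z: "0 \<le> z" "z \<le> t - 1" and p: "p = HK n z"
      by (auto simp: Z)
    have "coprime (6 * z + 1) 6" "coprime (6 * (t - 1 - z) + 5) 6"
      unfolding coprime_6_iff by presburger+
    moreover have "6 * z + 1 > 0" "6 * (t - 1 - z) + 5 > 0"
        "(6 * z + 1) + (6 * (t - 1 - z) + 5) = 2 * n"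
      using z by (auto simp: n)
    ultimately show "p \<in> reps n"
      unfolding p HK reps_def by blast
  qed
  moreover have "reps n \<subseteq> HK n ` Z n"
  proof
    \<comment> \<open>The pair is unordered, so the summand that is 1 mod 6 may be named
      \<open>a\<close>; it must be \<open>H n z\<close>, which forces \<open>z = a div 6\<close>.
      The bound \<open>z \<le> t - 1\<close> comes from \<open>b > 0\<close>.\<close>
    have wlog: "Upair a b \<in> HK n ` Z n"
      if "a > 0" "b > 0" "a + b = 2 * n" "a mod 6 = 1" for a b
    proof
      have "a = 6 * (a div 6) + 1"
        using that by presburger
      moreover from this have "b = 6 * (t - 1 - a div 6) + 5"
        using that n by (simp add: algebra_simps)
      ultimately show "Upair a b = HK n (a div 6)"
        by (simp add: HK)
      show "a div 6 \<in> Z n"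
        using that n unfolding Z by (simp; linarith)
    qed
    fix p assume "p \<in> reps n"
    then obtain a b where p: "p = Upair a b" and ab: "a > 0" "b > 0" "a + b = 2 * n"
      and "coprime a 6" "coprime b 6"
      by (auto simp: reps_def)
    \<comment> \<open>The sum is \<open>6 * t\<close>, whereas two summands that are 5 mod 6 would
      add up to 4 mod 6.\<close>
    then have "a mod 6 = 1 \<or> b mod 6 = 1"
      unfolding coprime_6_iff n by presburger
    then show "p \<in> HK n ` Z n"
      using wlog[of a b] wlog[of b a] ab unfolding p by (auto simp: add.commute Upair_inject[of a b b a, THEN iffD2])
  qed
  ultimately show ?thesis
    by (auto simp: bij_betw_def)
qed

lemma tau_in_Z: "z \<in> Z n \<Longrightarrow> tau n z \<in> Z n"
  by (auto simp: Z_def tau_def)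

lemma tau_tau: "tau n (tau n z) = z"
  by (simp add: tau_def)

text \<open>The two alternatives are the straight and the crossed match of the pairs; the crossed
  one reads \<open>H n y = K n z = H n (tau n z)\<close>.\<close>

lemma HK_eq_iff:
  assumes "n mod 3 \<noteq> 0"
  shows "HK n y = HK n z \<longleftrightarrow> y = z \<or> y = tau n z"
  using assms by (auto simp: HK_def H_def K_def tau_def delta_eq_mod)

lemma HK_fiber:
  assumes "n mod 3 \<noteq> 0" "z \<in> Z n"
  shows "{y \<in> Z n. HK n y = HK n z} = orbit (tau n) z"
  using assms tau_in_Z[of z n] by (auto simp: HK_eq_iff orbit_involution tau_tau)

lemma HK_fibers:
  assumes "n mod 3 \<noteq> 0"
  shows "{{z \<in> Z n. HK n z = p} | p. p \<in> HK n ` Z n} = {orbit (tau n) z | z. z \<in> Z n}"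
proof -
  \<comment> \<open>Every nonempty fiber is indexed by a parameter lying in it.\<close>
  have "{{z \<in> Z n. HK n z = p} | p. p \<in> HK n ` Z n} =
      (\<lambda>z. {y \<in> Z n. HK n y = HK n z}) ` Z n"
    by blast
  also have "\<dots> = orbit (tau n) ` Z n"
    using HK_fiber[OF assms] by (rule image_cong[OF refl])
  also have "\<dots> = {orbit (tau n) z | z. z \<in> Z n}"
    by blast
  finally show ?thesis .
qed

lemma m_ge:
  assumes "n > 0"
  shows "m n \<ge> -1"
  using assms unfolding m_def delta_eq_mod by (auto; presburger)

lemma ex_fixed_iff:
  assumes "n > 0"
  shows "(\<exists>z\<in>Z n. tau n z = z) \<longleftrightarrow> even (m n)"
proof
  assume "\<exists>z\<in>Z n. tau n z = z"
  then obtain z where "m n = 2 * z"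
    by (auto simp: tau_def)
  then show "even (m n)"
    by simp
next
  assume "even (m n)"
  then obtain z where "m n = 2 * z" ..
  \<comment> \<open>The bound -1, attained at \<open>n = 2\<close>, suffices: an even number that is
    at least -1 is nonnegative.\<close>
  moreover from this have "z \<ge> 0"
    using m_ge[OF assms] by simp
  ultimately show "\<exists>z\<in>Z n. tau n z = z"
    by (intro bexI[of _ z]) (auto simp: tau_def Z_def)
qed

text \<open>With \<open>m n = 2 * z\<close>, solving the definition of \<open>m\<close> for
  \<open>n\<close> gives \<open>6 * z + 1\<close> or \<open>6 * z + 5\<close>, which is the formula
  for \<open>H n z\<close>; \<open>K n z\<close> agrees because \<open>m n - z = z\<close>.\<close>

lemma fixed_imp_H_K_eq:
  assumes "n mod 3 \<noteq> 0" "tau n z = z"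
  shows "H n z = n \<and> K n z = n"
proof -
  have m: "m n = 2 * z"
    using assms(2) by (simp add: tau_def)
  consider "n mod 3 = 1" | "n mod 3 = 2"
    using assms(1) by atomize_elim presburger
  then show ?thesis
  proof cases
    case 1
    moreover from this have "(n - 1) div 3 = 2 * z"
      using m by (simp add: m_def delta_eq_mod)
    with 1 have "n = 6 * z + 1"
      by presburger
    ultimately show ?thesis
      using m by (simp add: H_def K_def delta_eq_mod)
  next
    case 2
    moreover from this have "(n - 5) div 3 = 2 * z"
      using m by (simp add: m_def delta_eq_mod)
    with 2 have "n = 6 * z + 5"
      by presburger
    ultimately show ?thesis
      using m by (simp add: H_def K_def delta_eq_mod)
  qed
qed

theorem proposition2p2:
  fixes n :: int
  assumes "n > 0"
  shows "(delta 3 n = 0 \<longrightarrow> bij_betw (HK n) (Z n) (reps n)) \<and>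
         (delta 3 n \<in> {1, 2} \<longrightarrow>
            (\<forall>z\<in>Z n. tau n z \<in> Z n \<and> tau n (tau n z) = z) \<and>
            {{z \<in> Z n. HK n z = p} | p. p \<in> HK n ` Z n} = {orbit (tau n) z | z. z \<in> Z n} \<and>
            ((\<exists>z\<in>Z n. tau n z = z) \<longleftrightarrow> even (m n)) \<and>
            (\<forall>z\<in>Z n. tau n z = z \<longrightarrow> H n z = n \<and> K n z = n))"
proof (intro conjI impI)
  assume "delta 3 n = 0"
  then show "bij_betw (HK n) (Z n) (reps n)"
    by (simp add: bij_betw_HK delta_eq_mod)
next
  assume "delta 3 n \<in> {1, 2}"
  then have n: "n mod 3 \<noteq> 0"
    by (auto simp: delta_eq_mod)
  show "\<forall>z\<in>Z n. tau n z \<in> Z n \<and> tau n (tau n z) = z"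
    by (simp add: tau_in_Z tau_tau)
  show "{{z \<in> Z n. HK n z = p} | p. p \<in> HK n ` Z n} = {orbit (tau n) z | z. z \<in> Z n}"
    using n by (rule HK_fibers)
  show "(\<exists>z\<in>Z n. tau n z = z) \<longleftrightarrow> even (m n)"
    using assms by (rule ex_fixed_iff)
  show "\<forall>z\<in>Z n. tau n z = z \<longrightarrow> H n z = n \<and> K n z = n"
    using fixed_imp_H_K_eq[OF n] by blast
qed

end
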